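(* (i) $M(1)=2$, $M(2)=5$, and $M(2^r)=7$ for every integer $r\ge 2$. (ii) $M(d)=4$ for every odd integer $d\ge 3$.
   Context: A pair $(a,b)\in\mathbb{Z}^2$ is multiplicatively dependent if $ab\neq 0$ and there is $(k_1,k_2)\in\mathbb{Z}^2\setminus\{(0,0)\}$ with $a^{k_1}b^{k_2}=1$. For $d\in\mathbb{Z}$, $\mathcal{M}(d)$ is the set of multiplicatively dependent pairs $(a,b)\in\mathbb{Z}^2$ with $ab\ne0$ and $b-a=d$, and $M(d)=|\mathcal{M}(d)|$. *)

theory Defs
  imports Complex_Main
begin

definition mult_dependent :: "int \<times> int \<Rightarrow> bool" where
  "mult_dependent = (\<lambda>(a, b). a * b \<noteq> 0 \<and>
     (\<exists>k1 k2 :: int. (k1, k2) \<noteq> (0, 0) \<and>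
        (of_int a :: rat) powi k1 * (of_int b :: rat) powi k2 = 1))"

definition dep_pairs :: "int \<Rightarrow> (int \<times> int) set" where
  "dep_pairs d = {(a, b). mult_dependent (a, b) \<and> a * b \<noteq> 0 \<and> b - a = d}"

text \<open>
  \<^const>\<open>card\<close> is 0 on infinite sets, so an equation between
  \<open>num_dep_pairs d\<close> and a positive number also says that the set is finite.
\<close>

definition num_dep_pairs :: "int \<Rightarrow> nat" where
  "num_dep_pairs d = card (dep_pairs d)"

end

theory Submission
  imports Defs "HOL-Computational_Algebra.Primes"
begin

text \<open>
  If \<open>|a|, |b| \<ge> 2\<close> and \<open>(a, b)\<close> is multiplicatively dependent, then \<open>|a| ^ m = |b| ^ n\<close> for some
  \<open>m, n \<ge> 1\<close>, so \<open>a\<close> and \<open>b\<close> have the same prime divisors, and all of these divide \<open>d = b - a\<close>.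
  For odd \<open>d\<close> this is impossible, since exactly one of \<open>a\<close>, \<open>b\<close> is even. For \<open>d = 2 ^ r\<close> both are
  powers of 2 up to sign, and \<open>2 ^ i + 2 ^ j = 2 ^ k\<close> forces \<open>i = j = k - 1\<close>. The remaining pairs
  have an entry \<open>\<plusminus>1\<close> and are always dependent.
\<close>

text \<open>One exponent may be zero, so that the lemma also rules out a power of a single entry
  being 1.\<close>

lemma abs_power_mult_abs_power_neq_1:
  fixes a b :: int
  assumes "\<bar>a\<bar> \<ge> 2" "\<bar>b\<bar> \<ge> 2" "m \<noteq> 0 \<or> n \<noteq> 0"
  shows "\<bar>a\<bar> ^ m * \<bar>b\<bar> ^ n \<noteq> 1"
proof
  assume eq: "\<bar>a\<bar> ^ m * \<bar>b\<bar> ^ n = 1"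
  moreover have "\<bar>a\<bar> ^ m \<ge> 0" by simp
  ultimately have "\<bar>a\<bar> ^ m = 1" "\<bar>b\<bar> ^ n = 1"
    using zmult_eq_1_iff[of "\<bar>a\<bar> ^ m" "\<bar>b\<bar> ^ n"] by linarith+
  moreover have "\<bar>a\<bar> ^ m > 1 \<or> \<bar>b\<bar> ^ n > 1"
    using assms by (auto intro!: one_less_power)
  ultimately show False by linarith
qed

lemma mult_dependent_imp_abs_powers_eq:
  assumes dep: "mult_dependent (a, b)" and a: "\<bar>a\<bar> \<ge> 2" and b: "\<bar>b\<bar> \<ge> 2"
  obtains m n :: nat where "m > 0" "n > 0" "\<bar>a\<bar> ^ m = \<bar>b\<bar> ^ n"
proof -
  obtain k l :: int where kl: "k \<noteq> 0 \<or> l \<noteq> 0"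
    and eq: "(of_int a :: rat) powi k * of_int b powi l = 1"
    using dep unfolding mult_dependent_def by auto
  define A B :: rat where "A = of_int \<bar>a\<bar>" and "B = of_int \<bar>b\<bar>"
  define m n where "m = nat \<bar>k\<bar>" and "n = nat \<bar>l\<bar>"
  have pos: "A > 0" "B > 0" using a b by (auto simp: A_def B_def)
  have mn: "m \<noteq> 0 \<or> n \<noteq> 0" using kl by (auto simp: m_def n_def)
  have AB: "A powi k * B powi l = 1"
    using arg_cong[OF eq, of abs] by (simp add: abs_mult power_int_abs A_def B_def)
  have k: "A powi k = (if k \<ge> 0 then A ^ m else inverse (A ^ m))"
    by (auto simp: power_int_def m_def power_inverse)
  have l: "B powi l = (if l \<ge> 0 then B ^ n else inverse (B ^ n))"
    by (auto simp: power_int_def n_def power_inverse)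
  \<comment> \<open>Exponents of equal sign give the first alternative, after inversion if both are
    negative; opposite signs give the second.\<close>
  have "A ^ m * B ^ n = 1 \<or> A ^ m = B ^ n"
    using AB pos unfolding k l by (auto simp: field_simps split: if_splits)
  moreover have "A ^ m * B ^ n \<noteq> 1"
    using abs_power_mult_abs_power_neq_1[OF a b mn] unfolding A_def B_def
    by (metis of_int_1 of_int_eq_iff of_int_mult of_int_power)
  ultimately have "A ^ m = B ^ n" by blast
  hence eq': "\<bar>a\<bar> ^ m = \<bar>b\<bar> ^ n"
    unfolding A_def B_def by (metis of_int_eq_iff of_int_power)
  \<comment> \<open>If one exponent were zero, \<open>eq'\<close> would make the other power equal
    to 1.\<close>
  have "m > 0" "n > 0"
    using abs_power_mult_abs_power_neq_1[OF a b, of m 0]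
      abs_power_mult_abs_power_neq_1[OF a b, of 0 n] mn eq' by (cases m; cases n; simp)+
  thus thesis using that eq' by blast
qed

lemma mult_dependent_prime_dvd_iff:
  assumes "mult_dependent (a, b)" "\<bar>a\<bar> \<ge> 2" "\<bar>b\<bar> \<ge> 2" "prime (p :: int)"
  shows "p dvd a \<longleftrightarrow> p dvd b"
proof -
  obtain m n :: nat where "m > 0" "n > 0" "\<bar>a\<bar> ^ m = \<bar>b\<bar> ^ n"
    using mult_dependent_imp_abs_powers_eq assms by metis
  thus ?thesis
    using prime_dvd_power_iff[OF assms(4), of m "\<bar>a\<bar>"] prime_dvd_power_iff[OF assms(4), of n "\<bar>b\<bar>"]
    by simp
qed

text \<open>Squaring the unit entry gives 1 whatever its sign; the other entry gets exponent
  0.\<close>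

lemma mult_dependent_unit:
  assumes "\<bar>a\<bar> = 1 \<or> \<bar>b\<bar> = 1" "a * b \<noteq> 0"
  shows "mult_dependent (a, b)"
proof -
  have "\<exists>k l :: int. (k \<noteq> 0 \<or> l \<noteq> 0) \<and> (of_int a :: rat) powi k * of_int b powi l = 1"
    using assms(1)
  proof
    assume "\<bar>a\<bar> = 1"
    hence "(of_int a :: rat) powi 2 * of_int b powi 0 = 1"
      by (auto simp: abs_if split: if_splits)
    thus ?thesis by (intro exI[of _ 2] exI[of _ 0]) auto
  next
    assume "\<bar>b\<bar> = 1"
    hence "(of_int a :: rat) powi 0 * of_int b powi 2 = 1"
      by (auto simp: abs_if split: if_splits)
    thus ?thesis by (intro exI[of _ 0] exI[of _ 2]) auto
  qed
  thus ?thesis using assms(2) unfolding mult_dependent_def by auto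
qed

text \<open>Raising to the powers \<open>2 * n\<close> and \<open>2 * m\<close> makes both sides
  \<open>x ^ (2 * m * n)\<close>; the factor 2 removes the signs, and \<open>n > 0\<close> keeps the
  exponent pair nonzero.\<close>

lemma mult_dependent_powers:
  fixes x :: int
  assumes "x \<noteq> 0" "\<bar>a\<bar> = x ^ m" "\<bar>b\<bar> = x ^ n" "n > 0"
  shows "mult_dependent (a, b)"
proof -
  have ab: "a \<noteq> 0" "b \<noteq> 0" using assms by auto
  have "\<bar>a\<bar> ^ (2 * n) = \<bar>b\<bar> ^ (2 * m)"
    unfolding assms(2,3) by (simp flip: power_mult add: mult.commute mult.left_commute)
  hence "a ^ (2 * n) = b ^ (2 * m)"
    by (simp add: power_even_abs)
  hence "(of_int a :: rat) ^ (2 * n) = of_int b ^ (2 * m)"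
    by (metis of_int_power)
  hence "(of_int a :: rat) powi int (2 * n) * of_int b powi (- int (2 * m)) = 1"
    using ab unfolding power_int_minus power_int_of_nat by simp
  moreover have "(int (2 * n), - int (2 * m)) \<noteq> (0, 0)" using assms(4) by simp
  ultimately show ?thesis
    using ab unfolding mult_dependent_def by (simp only: prod.case mult_eq_0_iff) blast
qed

definition unit_pairs :: "int \<Rightarrow> (int \<times> int) set" where
  "unit_pairs d = {(a, b). (\<bar>a\<bar> = 1 \<or> \<bar>b\<bar> = 1) \<and> a * b \<noteq> 0 \<and> b - a = d}"

text \<open>Fixing one entry as 1 or -1 leaves four candidates. For small \<open>d\<close> some
  coincide or contain a zero, hence the filter.\<close>

lemma unit_pairs_eq:
  "unit_pairs d = {(a, b) \<in> {(1, 1 + d), (-1, d - 1), (1 - d, 1), (-1 - d, -1)}. a \<noteq> 0 \<and> b \<noteq> 0}"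
  unfolding unit_pairs_def by (auto simp: abs_if split: if_splits)

lemma dep_pairs_eq:
  "dep_pairs d = unit_pairs d \<union> {(a, b). mult_dependent (a, b) \<and> \<bar>a\<bar> \<ge> 2 \<and> \<bar>b\<bar> \<ge> 2 \<and> b - a = d}"
proof -
  have "\<bar>x\<bar> = 1 \<or> \<bar>x\<bar> \<ge> 2" if "x \<noteq> 0" for x :: int using that by linarith
  thus ?thesis
    unfolding dep_pairs_def unit_pairs_def using mult_dependent_unit by fastforce
qed

lemma dep_pairs_odd:
  assumes "odd d"
  shows "dep_pairs d = unit_pairs d"
proof -
  have "\<not> mult_dependent (a, b)" if "\<bar>a\<bar> \<ge> 2" "\<bar>b\<bar> \<ge> 2" "b - a = d" for a b
  proof
    assume "mult_dependent (a, b)"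
    hence "even a \<longleftrightarrow> even b"
      using mult_dependent_prime_dvd_iff[of a b 2] that by simp
    thus False using that assms by auto
  qed
  thus ?thesis unfolding dep_pairs_eq by blast
qed

text \<open>The odd part of \<open>x\<close> has no prime divisor, so it is a unit.\<close>

lemma eq_power_2_if_only_prime_2:
  fixes x :: int
  assumes "x \<noteq> 0" "\<And>p. prime p \<Longrightarrow> p dvd x \<Longrightarrow> p = 2"
  obtains k where "\<bar>x\<bar> = 2 ^ k"
proof -
  obtain q where q: "x = 2 ^ multiplicity 2 x * q" "\<not> 2 dvd q"
    using multiplicity_decompose'[of x 2] assms(1) by auto
  have "is_unit q"
  proof (rule ccontr)
    assume "\<not> is_unit q"
    moreover have "q \<noteq> 0" using q(2) by auto
    ultimately obtain p where p: "prime p" "p dvd q" using prime_divisor_exists by blast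
    hence "p = 2" using assms(2)[of p] q(1) by (metis dvd_mult)
    thus False using p q by simp
  qed
  hence "\<bar>x\<bar> = 2 ^ multiplicity 2 x"
    using arg_cong[OF q(1), of abs] by (simp add: abs_mult)
  thus thesis using that by blast
qed

text \<open>If \<open>i < j\<close>, then also \<open>i < k\<close>, so \<open>2 ^ Suc i\<close>
  would divide \<open>2 ^ k - 2 ^ j = 2 ^ i\<close>.\<close>

lemma power_2_add_power_2_le:
  assumes "(2 :: int) ^ i + 2 ^ j = 2 ^ k"
  shows "j \<le> i"
proof (rule ccontr)
  assume "\<not> j \<le> i"
  hence ij: "i < j" by simp
  have "(2 :: int) ^ i < 2 ^ k" using assms zero_less_power[of "2 :: int" j] by linarith
  hence ik: "i < k" by simp
  have "(2 :: int) ^ Suc i dvd 2 ^ j" "(2 :: int) ^ Suc i dvd 2 ^ k"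
    using ij ik by (intro le_imp_power_dvd; simp)+
  hence "(2 :: int) ^ Suc i dvd 2 ^ i"
    using assms dvd_diff[of "(2 :: int) ^ Suc i" "2 ^ k" "2 ^ j"] by (metis add_diff_cancel_right')
  hence "(2 :: int) ^ Suc i \<le> 2 ^ i" by (rule zdvd_imp_le) simp
  thus False by simp
qed

lemma power_2_add_power_2:
  assumes "(2 :: int) ^ i + 2 ^ j = 2 ^ k"
  shows "i = j \<and> k = Suc i"
proof -
  have ij: "i = j"
    using power_2_add_power_2_le[of i j k] power_2_add_power_2_le[of j i k] assms by simp
  hence "(2 :: int) ^ Suc i = 2 ^ k" using assms by simp
  thus ?thesis using ij by (metis power_inject_exp one_less_numeral_iff semiring_norm(76))
qed

lemma mult_dependent_diff_power_2:
  assumes dep: "mult_dependent (a, b)" and a: "\<bar>a\<bar> \<ge> 2" and b: "\<bar>b\<bar> \<ge> 2" and d: "b - a = 2 ^ r"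
  shows "(a, b) \<in> {(2 ^ r, 2 ^ Suc r), (- (2 ^ Suc r), - (2 ^ r))} \<or>
         (\<exists>i. r = Suc i \<and> a = - (2 ^ i) \<and> b = 2 ^ i)"
proof -
  have two: "p = 2" if "prime p" "p dvd a \<or> p dvd b" for p :: int
  proof -
    have "p dvd a" "p dvd b" using mult_dependent_prime_dvd_iff[OF dep a b that(1)] that(2) by auto
    hence "p dvd 2 ^ r" using d by (metis dvd_diff)
    hence "p dvd 2" using that(1) prime_dvd_power by blast
    thus ?thesis using that(1) by (simp add: primes_dvd_imp_eq)
  qed
  obtain i where i: "\<bar>a\<bar> = 2 ^ i"
    by (rule eq_power_2_if_only_prime_2[of a]) (use a two in auto)
  obtain j where j: "\<bar>b\<bar> = 2 ^ j"
    by (rule eq_power_2_if_only_prime_2[of b]) (use b two in auto)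
  have pos: "(2 :: int) ^ r > 0" by simp
  \<comment> \<open>In the first three sign patterns \<open>b - a = 2 ^ r\<close> rearranges to a
    sum of two powers of 2 being a third; in the last one \<open>b - a\<close> is negative.\<close>
  consider "a = 2 ^ i" "b = 2 ^ j" | "a = - (2 ^ i)" "b = - (2 ^ j)"
    | "a = - (2 ^ i)" "b = 2 ^ j" | "a = 2 ^ i" "b = - (2 ^ j)"
    using i j by linarith
  thus ?thesis
  proof cases
    case 1
    thus ?thesis using power_2_add_power_2[of i r j] d by auto
  next
    case 2
    thus ?thesis using power_2_add_power_2[of j r i] d by auto
  next
    case 3
    thus ?thesis using power_2_add_power_2[of i j r] d by auto
  next
    case 4
    thus ?thesis using d pos zero_less_power[of "2 :: int" i] zero_less_power[of "2 :: int" j]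
      by linarith
  qed
qed

lemma dep_pairs_power_2:
  "dep_pairs (2 ^ Suc i) = unit_pairs (2 ^ Suc i) \<union>
     {(2 ^ Suc i, 2 ^ Suc (Suc i)), (- (2 ^ Suc (Suc i)), - (2 ^ Suc i)), (- (2 ^ i), 2 ^ i)}"
    (is "_ = ?U \<union> ?S")
proof
  show "dep_pairs (2 ^ Suc i) \<subseteq> ?U \<union> ?S"
    unfolding dep_pairs_eq using mult_dependent_diff_power_2[of _ _ "Suc i"] by blast
next
  have "mult_dependent (2 ^ Suc i, 2 ^ Suc (Suc i))"
    by (rule mult_dependent_powers[of 2 _ "Suc i" _ "Suc (Suc i)"]) auto
  moreover have "mult_dependent (- (2 ^ Suc (Suc i)), - (2 ^ Suc i))"
    by (rule mult_dependent_powers[of 2 _ "Suc (Suc i)" _ "Suc i"]) auto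
  \<comment> \<open>The base is \<open>2 ^ i\<close> with exponent 1, since base 2 would need
    \<open>i > 0\<close>.\<close>
  moreover have "mult_dependent (- (2 ^ i), 2 ^ i)"
    by (rule mult_dependent_powers[of "2 ^ i" _ 1 _ 1]) auto
  ultimately have "?S \<subseteq> dep_pairs (2 ^ Suc i)"
    unfolding dep_pairs_def by auto
  thus "?U \<union> ?S \<subseteq> dep_pairs (2 ^ Suc i)"
    unfolding dep_pairs_eq by blast
qed

text \<open>From \<open>d \<ge> 2\<close> on no entry vanishes, but for \<open>d = 2\<close> the two
  middle pairs coincide.\<close>

lemma unit_pairs_generic:
  assumes "d \<ge> 2"
  shows "unit_pairs d = {(1, 1 + d), (-1, d - 1), (1 - d, 1), (-1 - d, -1)}"
  unfolding unit_pairs_eq using assms by auto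

theorem theorem4p2:
  shows "(num_dep_pairs 1 = 2 \<and> num_dep_pairs 2 = 5 \<and>
          (\<forall>r::nat. r \<ge> 2 \<longrightarrow> num_dep_pairs (2 ^ r) = 7)) \<and>
         (\<forall>d::int. odd d \<and> d \<ge> 3 \<longrightarrow> num_dep_pairs d = 4)"
proof (intro conjI allI impI)
  \<comment> \<open>The candidates (-1, 0) and (0, 1) drop out.\<close>
  have "dep_pairs 1 = {(1, 2), (-2, -1)}"
    unfolding dep_pairs_odd[OF odd_one] unit_pairs_eq by auto
  thus "num_dep_pairs 1 = 2" by (simp add: num_dep_pairs_def)
next
  \<comment> \<open>The pair (-1, 1) arises three times, twice as a unit pair and once as
    \<open>(- (2 ^ 0), 2 ^ 0)\<close>, so seven listed pairs leave five.\<close>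
  have "dep_pairs 2 = {(1, 3), (-1, 1), (-3, -1), (2, 4), (-4, -2)}"
    using dep_pairs_power_2[of 0] unit_pairs_generic[of 2] by auto
  thus "num_dep_pairs 2 = 5" by (simp add: num_dep_pairs_def)
next
  fix r :: nat
  assume "r \<ge> 2"
  then obtain s where r: "r = Suc (Suc s)" by (metis add_2_eq_Suc le_Suc_ex)
  \<comment> \<open>Now \<open>2 ^ r = 4 * x\<close>, and all entries are linear in
    \<open>x\<close>.\<close>
  define x :: int where "x = 2 ^ s"
  have x: "x \<ge> 1" by (simp add: x_def)
  have "unit_pairs (4 * x) = {(1, 1 + 4 * x), (-1, 4 * x - 1), (1 - 4 * x, 1), (-1 - 4 * x, -1)}"
    by (rule unit_pairs_generic) (use x in linarith)
  hence "dep_pairs (2 ^ r) = {(1, 1 + 4 * x), (-1, 4 * x - 1), (1 - 4 * x, 1), (-1 - 4 * x, -1),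
      (4 * x, 8 * x), (- (8 * x), - (4 * x)), (- (2 * x), 2 * x)}"
    using dep_pairs_power_2[of "Suc s"] by (simp add: r x_def insert_commute)
  \<comment> \<open>These parity facts separate the four unit pairs from the other three.\<close>
  moreover have "4 * x \<noteq> 1" "2 * x \<noteq> 1" "8 * x \<noteq> 1" by presburger+
  ultimately show "num_dep_pairs (2 ^ r) = 7" using x by (simp add: num_dep_pairs_def)
next
  fix d :: int
  assume "odd d \<and> d \<ge> 3"
  hence "d \<ge> 3" "dep_pairs d = {(1, 1 + d), (-1, d - 1), (1 - d, 1), (-1 - d, -1)}"
    using dep_pairs_odd[of d] unit_pairs_generic[of d] by auto
  \<comment> \<open>For positive \<open>d\<close>, two of these pairs can agree only if
    \<open>d = 2\<close>.\<close>
  thus "num_dep_pairs d = 4" by (simp add: num_dep_pairs_def)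
qed

end
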